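(* Let $\mathcal{P}$ be a finite lattice. The following statements are equivalent: (i) $\mathcal{P}$ is locally branched; (ii) every interval of $\mathcal{P}$ is atomic; (iii) every interval of $\mathcal{P}$ is coatomic.
   Context: $\prec$ denotes the cover relation. A finite poset is locally branched if for every saturated chain $a\prec b\prec c$ there exists an element $d\neq b$ with $a<d<c$. For $a\le b$ in $\mathcal{P}$, the interval is $[a,b]=\{p\in\mathcal{P} : a\le p\le b\}$, regarded as a lattice with lower bound $a$ and upper bound $b$. In a finite lattice with lower bound $\hat 0$ and upper bound $\hat 1$, atoms are the upper covers of $\hat 0$ and coatoms are the lower covers of $\hat 1$; the lattice is atomic if every element is a join of atoms, and coatomic if every element is a meet of coatoms (the empty join is $\hat 0$ and the empty meet is $\hat 1$). *)

theory Defs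
  imports "HOL-Algebra.Lattice"
begin

definition covered_by :: "('a, 'b) gorder_scheme \<Rightarrow> 'a \<Rightarrow> 'a \<Rightarrow> bool" where
  "covered_by P a b \<longleftrightarrow>
     a \<in> carrier P \<and> b \<in> carrier P \<and> a \<sqsubset>\<^bsub>P\<^esub> b \<and>
     \<not> (\<exists>x\<in>carrier P. a \<sqsubset>\<^bsub>P\<^esub> x \<and> x \<sqsubset>\<^bsub>P\<^esub> b)"

definition locally_branched :: "('a, 'b) gorder_scheme \<Rightarrow> bool" where
  "locally_branched P \<longleftrightarrow>
     (\<forall>a b c. covered_by P a b \<and> covered_by P b c \<longrightarrow>
        (\<exists>d\<in>carrier P. d \<noteq> b \<and> a \<sqsubset>\<^bsub>P\<^esub> d \<and> d \<sqsubset>\<^bsub>P\<^esub> c))"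

text \<open>The interval is an order of its own: bounds, covers, joins and meets of
  \<^term>\<open>interval P a b\<close> are all taken inside the interval, so that the empty join is
  \<^term>\<open>a\<close> and the empty meet is \<^term>\<open>b\<close>.\<close>

definition interval :: "('a, 'b) gorder_scheme \<Rightarrow> 'a \<Rightarrow> 'a \<Rightarrow> ('a, 'b) gorder_scheme" where
  "interval P a b = P\<lparr>carrier := \<lbrace>a..b\<rbrace>\<^bsub>P\<^esub>\<rparr>"

definition atoms :: "('a, 'b) gorder_scheme \<Rightarrow> 'a set" where
  "atoms L = {p. covered_by L \<bottom>\<^bsub>L\<^esub> p}"

definition coatoms :: "('a, 'b) gorder_scheme \<Rightarrow> 'a set" where
  "coatoms L = {p. covered_by L p \<top>\<^bsub>L\<^esub>}"

text \<open>The library's bounds and arbitrary joins and meets are chosen by \<open>SOME\<close>; the next two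
  notions are meant for a nonempty finite lattice, in which all of these exist.\<close>

definition atomic :: "('a, 'b) gorder_scheme \<Rightarrow> bool" where
  "atomic L \<longleftrightarrow> (\<forall>x\<in>carrier L. \<exists>S. S \<subseteq> atoms L \<and> x = \<Squnion>\<^bsub>L\<^esub>S)"

definition coatomic :: "('a, 'b) gorder_scheme \<Rightarrow> bool" where
  "coatomic L \<longleftrightarrow> (\<forall>x\<in>carrier L. \<exists>S. S \<subseteq> coatoms L \<and> x = \<Sqinter>\<^bsub>L\<^esub>S)"

end

(* If x were not the join of the atoms of [a,b] below it, some element u would lie above all of
   these atoms but not above x. A minimal q in [a,x] not below u then has q \<sqinter> u as its only
   lower cover in [a,q]. Unless q is itself an atom, a chain s \<prec> q \<sqinter> u \<prec> q in [a,q] has no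
   branching. Conversely, an unbranched chain a \<prec> b \<prec> c gives the three-element interval [a,c],
   in which c is not a join of atoms. Local branching is self-dual, which gives the
   coatomic part. *)
theory Submission
  imports Defs
begin

lemma carrier_interval [simp]: "carrier (interval L a b) = \<lbrace>a..b\<rbrace>\<^bsub>L\<^esub>"
  by (simp add: interval_def)

lemma le_interval [simp]: "x \<sqsubseteq>\<^bsub>interval L a b\<^esub> y \<longleftrightarrow> x \<sqsubseteq>\<^bsub>L\<^esub> y"
  by (simp add: interval_def)

lemma lless_interval [simp]: "x \<sqsubset>\<^bsub>interval L a b\<^esub> y \<longleftrightarrow> x \<sqsubset>\<^bsub>L\<^esub> y"
  by (simp add: interval_def lless_def)

text \<open>This carries results on atoms over to coatoms: the bounds trade places because the order
  is reversed.\<close>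

lemma interval_dual: "interval (inv_gorder L) b a = inv_gorder (interval L a b)"
  by (auto simp: interval_def at_least_at_most_def)

context partial_order
begin

lemma partial_order_interval: "partial_order (interval L a b)"
proof -
  interpret I: weak_partial_order "interval L a b"
    unfolding interval_def
    by (rule weak_partial_order_subset) (auto simp: weak_partial_order_axioms at_least_at_most_def)
  show ?thesis
    by unfold_locales (simp add: interval_def eq_is_equal)
qed

text \<open>Joins are \<open>SOME\<close> choices. Antisymmetry makes least elements unique, so
  exhibiting one least upper bound determines the chosen value.\<close>

lemma sup_eqI: "is_lub L s S \<Longrightarrow> \<Squnion>S = s"
  unfolding sup_def by (rule some_equality) (auto intro: least_unique)

lemma bottom_eqI: "least L x (carrier L) \<Longrightarrow> \<bottom> = x"
  unfolding bottom_def by (rule some_equality) (auto intro: least_unique)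

lemma interval_bottom:
  assumes "a \<in> carrier L" "b \<in> carrier L" "a \<sqsubseteq> b"
  shows "\<bottom>\<^bsub>interval L a b\<^esub> = a"
  by (rule partial_order.bottom_eqI[OF partial_order_interval])
     (use assms in \<open>auto simp: least_def at_least_at_most_def\<close>)

text \<open>Intervals are convex: whatever lies strictly between \<open>a\<close> and some
  \<open>p \<sqsubseteq> b\<close> is already in the interval. Hence restricting to the interval
  creates no new covers of \<open>a\<close>.\<close>

lemma atoms_interval:
  assumes "a \<in> carrier L" "b \<in> carrier L" "a \<sqsubseteq> b"
  shows "atoms (interval L a b) = {p. covered_by L a p \<and> p \<sqsubseteq> b}"
  unfolding atoms_def interval_bottom[OF assms]
proof -
  have "x \<sqsubseteq> b" if "x \<in> carrier L" "p \<in> carrier L" "x \<sqsubset> p" "p \<sqsubseteq> b" for x p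
    using that assms le_trans[of x p b] by (simp add: lless_eq)
  then have "covered_by (interval L a b) a p \<longleftrightarrow> covered_by L a p \<and> p \<sqsubseteq> b" for p
    using assms by (auto simp: covered_by_def at_least_at_most_def lless_imp_le)
  then show "{p. covered_by (interval L a b) a p} = {p. covered_by L a p \<and> p \<sqsubseteq> b}"
    by simp
qed

lemma finite_minimal:
  assumes "finite A" "A \<subseteq> carrier L" "A \<noteq> {}"
  obtains m where "m \<in> A" "\<And>x. x \<in> A \<Longrightarrow> \<not> x \<sqsubset> m"
proof -
  have "asymp_on A (\<sqsubset>)"
    using assms by (intro asymp_onI) (meson lless_antisym subsetD)
  moreover have "transp_on A (\<sqsubset>)"
    using assms by (intro transp_onI) (meson lless_trans subsetD)
  ultimately obtain m where "m \<in> A" "\<forall>x\<in>A. x \<noteq> m \<longrightarrow> \<not> x \<sqsubset> m"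
    using Finite_Set.bex_min_element[of A "(\<sqsubset>)"] assms by blast
  then show thesis using that[of m] lless_eq by blast
qed

lemma covered_by_dual: "covered_by (inv_gorder L) a b \<longleftrightarrow> covered_by L b a"
  by (auto simp: covered_by_def lless_def eq_is_equal)

lemma lless_dual: "a \<sqsubset>\<^bsub>inv_gorder L\<^esub> b \<longleftrightarrow> b \<sqsubset> a"
  by (auto simp: lless_def eq_is_equal)

lemma locally_branched_dual: "locally_branched (inv_gorder L) \<longleftrightarrow> locally_branched L"
  unfolding locally_branched_def covered_by_dual lless_dual by (auto; blast)

lemma atomic_dual: "atomic (inv_gorder L) \<longleftrightarrow> coatomic L"
  unfolding atomic_def coatomic_def atoms_def coatoms_def covered_by_dual by simp

lemma finite_lower_cover:
  assumes "finite (carrier L)" "a \<in> carrier L" "r \<in> carrier L" "a \<sqsubset> r"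
  obtains s where "a \<sqsubseteq> s" "covered_by L s r"
proof -
  interpret D: partial_order "inv_gorder L" by (rule dual_order)
  let ?A = "{s \<in> carrier L. a \<sqsubseteq> s \<and> s \<sqsubset> r}"
  \<comment> \<open>Minimality in the dual order is maximality in \<open>L\<close>, so
    \<open>s\<close> is a maximal element of \<open>?A\<close>.\<close>
  obtain s where s: "s \<in> ?A" "\<And>x. x \<in> ?A \<Longrightarrow> \<not> s \<sqsubset> x"
    by (rule D.finite_minimal[of ?A]) (use assms lless_dual in auto)
  have "\<not> (s \<sqsubset> x \<and> x \<sqsubset> r)" if "x \<in> carrier L" for x
    using s that assms le_trans[of a s x] by (auto simp: lless_eq)
  then show thesis
    using that[of s] s assms by (auto simp: covered_by_def)
qed

lemma locally_branched_if_atomic_intervals: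
  assumes "\<And>a b. \<lbrakk>a \<in> carrier L; b \<in> carrier L; a \<sqsubseteq> b\<rbrakk> \<Longrightarrow> atomic (interval L a b)"
  shows "locally_branched L"
  unfolding locally_branched_def
proof (intro allI impI)
  fix a b c
  assume "covered_by L a b \<and> covered_by L b c"
  then have ab: "covered_by L a b" and bc: "covered_by L b c" by auto
  then have car: "a \<in> carrier L" "b \<in> carrier L" "c \<in> carrier L"
    and lt: "a \<sqsubset> b" "b \<sqsubset> c"
    by (auto simp: covered_by_def)
  then have ac: "a \<sqsubset> c" by (blast intro: lless_trans)
  show "\<exists>d\<in>carrier L. d \<noteq> b \<and> a \<sqsubset> d \<and> d \<sqsubset> c"
  proof (rule ccontr)
    assume no_branch: "\<not> ?thesis"
    interpret I: partial_order "interval L a c" by (rule partial_order_interval)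
    \<comment> \<open>An atom other than \<open>b\<close> would either lie strictly below
      \<open>c\<close>, which \<open>no_branch\<close> forbids, or be \<open>c\<close> itself, which
      is excluded here because \<open>b\<close> lies between.\<close>
    have "\<not> covered_by L a c"
      using lt car by (auto simp: covered_by_def)
    then have "atoms (interval L a c) \<subseteq> {b}"
      using atoms_interval[of a c] ac car no_branch
      by (auto simp: covered_by_def lless_eq)
    moreover obtain S where S: "S \<subseteq> atoms (interval L a c)" "c = \<Squnion>\<^bsub>interval L a c\<^esub>S"
      using assms[of a c] ac car unfolding atomic_def
      by (auto simp: lless_eq at_least_at_most_def)
    ultimately consider "S = {}" | "S = {b}" by blast
    then show False
    proof cases
      case 1
      \<comment> \<open>Every element of the interval bounds the empty set, so the empty join is the
        bottom \<open>a\<close> and cannot be \<open>c\<close>.\<close>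
      have "is_lub (interval L a c) a S"
        using 1 car ac by (auto simp: least_def at_least_at_most_def lless_eq)
      with I.sup_eqI S ac show False by (auto simp: lless_eq)
    next
      case 2
      have "is_lub (interval L a c) b {b}"
        by (rule I.sup_of_singletonI) (use car lt in \<open>auto simp: at_least_at_most_def lless_eq\<close>)
      with 2 I.sup_eqI S lt show False by (auto simp: lless_eq)
    qed
  qed
qed

end

context lattice
begin

text \<open>This supplies leastness of \<open>x\<close> among upper bounds: an element
  \<open>u\<close> of the interval that is not above \<open>x\<close> already fails to bound some
  atom below \<open>x\<close>.\<close>

lemma locally_branched_separating_atom:
  assumes fin: "finite (carrier L)" and lb: "locally_branched L"
    and car: "a \<in> carrier L" "x \<in> carrier L" "u \<in> carrier L"
    and le: "a \<sqsubseteq> x" "a \<sqsubseteq> u" and nle: "\<not> x \<sqsubseteq> u"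
  obtains q where "covered_by L a q" "q \<sqsubseteq> x" "\<not> q \<sqsubseteq> u"
proof -
  let ?A = "{y \<in> carrier L. a \<sqsubseteq> y \<and> y \<sqsubseteq> x \<and> \<not> y \<sqsubseteq> u}"
  \<comment> \<open>The set is nonempty because it contains \<open>x\<close>.\<close>
  have "finite ?A" "?A \<subseteq> carrier L" "?A \<noteq> {}" using assms by auto
  then obtain q where q: "q \<in> ?A" and min: "\<And>y. y \<in> ?A \<Longrightarrow> \<not> y \<sqsubset> q"
    by (rule finite_minimal) (blast intro: that)
  define r where "r = q \<sqinter> u"
  have r: "r \<in> carrier L" "r \<sqsubseteq> q" "r \<sqsubseteq> u" "a \<sqsubseteq> r"
    using q car le by (auto simp: r_def meet_left meet_right meet_le)
  \<comment> \<open>Minimality of \<open>q\<close> forces all elements of the interval strictly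
    below \<open>q\<close> to lie under \<open>u\<close>, hence under \<open>q \<sqinter> u\<close>.
    So \<open>r\<close> is the greatest of them, which also makes \<open>q\<close> a cover of
    \<open>r\<close>.\<close>
  have below_r: "z \<sqsubseteq> r" if "z \<in> carrier L" "a \<sqsubseteq> z" "z \<sqsubset> q" for z
  proof -
    have "z \<sqsubseteq> x" using that q car le_trans[of z q x] by (auto simp: lless_eq)
    then have "z \<sqsubseteq> u" using min[of z] that by auto
    then show ?thesis using that q car by (auto simp: r_def lless_eq intro!: meet_le)
  qed
  have rq: "r \<sqsubset> q" using r q by (auto simp: lless_eq)
  have cov: "covered_by L r q"
    unfolding covered_by_def
  proof (intro conjI)
    show "\<not> (\<exists>z\<in>carrier L. r \<sqsubset> z \<and> z \<sqsubset> q)"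
    proof
      assume "\<exists>z\<in>carrier L. r \<sqsubset> z \<and> z \<sqsubset> q"
      then obtain z where z: "z \<in> carrier L" "r \<sqsubset> z" "z \<sqsubset> q" by auto
      then have "a \<sqsubseteq> z" using r car le_trans[of a r z] by (auto simp: lless_eq)
      then have "z \<sqsubseteq> r" using below_r z by auto
      then show False using z r by (auto simp: lless_eq)
    qed
  qed (use r q rq in auto)
  have "r = a"
  proof (rule ccontr)
    assume "r \<noteq> a"
    then obtain s where s: "a \<sqsubseteq> s" "covered_by L s r"
      using finite_lower_cover[OF fin, of a r] r car by (auto simp: lless_eq)
    obtain d where d: "d \<in> carrier L" "d \<noteq> r" "s \<sqsubset> d" "d \<sqsubset> q"
      using lb s cov unfolding locally_branched_def by blast
    have "s \<in> carrier L" using s by (auto simp: covered_by_def)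
    then have "a \<sqsubseteq> d" using s d car le_trans[of a s d] by (auto simp: lless_eq)
    \<comment> \<open>Being strictly below \<open>q\<close>, the branching element \<open>d\<close>
      falls under \<open>r\<close>, and so strictly between \<open>s\<close> and its cover
      \<open>r\<close>.\<close>
    then have "d \<sqsubset> r" using below_r d by (auto simp: lless_eq)
    then show False using s d by (auto simp: covered_by_def)
  qed
  then show thesis using that[of q] cov q by auto
qed

text \<open>The set of all atoms below \<open>x\<close> serves as witness. The case
  \<open>x = a\<close> needs no separate treatment: the set is then empty and its join in the
  interval is \<open>a\<close>.\<close>

lemma atomic_interval_if_locally_branched:
  assumes fin: "finite (carrier L)" and lb: "locally_branched L"
    and ab: "a \<in> carrier L" "b \<in> carrier L" "a \<sqsubseteq> b"
  shows "atomic (interval L a b)"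
  unfolding atomic_def
proof
  fix x assume "x \<in> carrier (interval L a b)"
  then have x: "x \<in> carrier L" "a \<sqsubseteq> x" "x \<sqsubseteq> b" by (auto simp: at_least_at_most_def)
  interpret I: partial_order "interval L a b" by (rule partial_order_interval)
  let ?S = "{p. covered_by L a p \<and> p \<sqsubseteq> x}"
  have S: "?S \<subseteq> \<lbrace>a..b\<rbrace>"
    using x ab le_trans[of _ x b] by (auto simp: covered_by_def at_least_at_most_def lless_eq)
  have "is_lub (interval L a b) x ?S"
  proof (rule least_UpperI)
    fix u assume u: "u \<in> Upper (interval L a b) ?S"
    then have "u \<in> carrier L" "a \<sqsubseteq> u" by (auto simp: Upper_def at_least_at_most_def)
    moreover have "p \<sqsubseteq> u" if "covered_by L a p" "p \<sqsubseteq> x" for p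
      using u that S by (auto simp: Upper_def)
    \<comment> \<open>Otherwise a separating atom would lie below \<open>x\<close> but not below
      \<open>u\<close>, although \<open>u\<close> bounds all atoms below \<open>x\<close>.\<close>
    ultimately show "x \<sqsubseteq>\<^bsub>interval L a b\<^esub> u"
      using locally_branched_separating_atom[OF fin lb] ab x by (metis le_interval)
  qed (use S x in \<open>auto simp: at_least_at_most_def\<close>)
  then have "x = \<Squnion>\<^bsub>interval L a b\<^esub>?S" by (simp add: I.sup_eqI)
  moreover have "?S \<subseteq> atoms (interval L a b)"
    using S by (auto simp: atoms_interval[OF ab] at_least_at_most_def)
  ultimately show "\<exists>S. S \<subseteq> atoms (interval L a b) \<and> x = \<Squnion>\<^bsub>interval L a b\<^esub>S" by blast
qed

lemma locally_branched_iff_atomic_intervals: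
  assumes "finite (carrier L)"
  shows "locally_branched L \<longleftrightarrow>
           (\<forall>a\<in>carrier L. \<forall>b\<in>carrier L. a \<sqsubseteq> b \<longrightarrow> atomic (interval L a b))"
  using assms atomic_interval_if_locally_branched locally_branched_if_atomic_intervals by blast

text \<open>This is the atomic equivalence applied to the dual lattice, which is locally branched
  exactly when \<open>L\<close> is.\<close>

lemma locally_branched_iff_coatomic_intervals:
  assumes "finite (carrier L)"
  shows "locally_branched L \<longleftrightarrow>
           (\<forall>a\<in>carrier L. \<forall>b\<in>carrier L. a \<sqsubseteq> b \<longrightarrow> coatomic (interval L a b))"
proof -
  have "atomic (interval (inv_gorder L) b a) \<longleftrightarrow> coatomic (interval L a b)" for a b
    unfolding interval_dual by (rule partial_order.atomic_dual[OF partial_order_interval])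
  then show ?thesis
    using lattice.locally_branched_iff_atomic_intervals[OF dual_lattice] assms
    by (auto simp: locally_branched_dual)
qed

end

theorem proposition2p4:
  fixes P :: "('a, 'b) gorder_scheme"
  assumes "lattice P" and "finite (carrier P)"
  shows "(locally_branched P \<longleftrightarrow>
            (\<forall>a\<in>carrier P. \<forall>b\<in>carrier P. a \<sqsubseteq>\<^bsub>P\<^esub> b \<longrightarrow> atomic (interval P a b))) \<and>
         ((\<forall>a\<in>carrier P. \<forall>b\<in>carrier P. a \<sqsubseteq>\<^bsub>P\<^esub> b \<longrightarrow> atomic (interval P a b)) \<longleftrightarrow>
            (\<forall>a\<in>carrier P. \<forall>b\<in>carrier P. a \<sqsubseteq>\<^bsub>P\<^esub> b \<longrightarrow> coatomic (interval P a b)))"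
  using lattice.locally_branched_iff_atomic_intervals[OF assms]
    lattice.locally_branched_iff_coatomic_intervals[OF assms] by blast

end
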